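(* For all integers $n \geq 1$ and $1 \leq k \leq n$, the hyperbolicity cone $\Lambda_+(e_k,\mathbf{1})$ of the elementary symmetric polynomial $e_k(x_1,\ldots,x_n)=\sum_{1\leq i_1<\cdots<i_k\leq n} x_{i_1}\cdots x_{i_k}$ with respect to $\mathbf{1}=(1,\ldots,1)^T$ is spectrahedral.
   Context: A homogeneous polynomial $h\in\mathbb{R}[x_1,\ldots,x_n]$ is hyperbolic with respect to $\mathbf{e}\in\mathbb{R}^n$ if $h(\mathbf{e})\neq 0$ and for every $\mathbf{x}\in\mathbb{R}^n$ the univariate polynomial $t\mapsto h(\mathbf{x}+t\mathbf{e})$ has only real zeros. The hyperbolicity cone $\Lambda_+(h,\mathbf{e})$ is the closure of the connected component of $\{\mathbf{x}\in\mathbb{R}^n: h(\mathbf{x})\neq 0\}$ containing $\mathbf{e}$. The polynomial $e_k$ is hyperbolic with respect to $\mathbf{1}$. A cone in $\mathbb{R}^n$ is spectrahedral if it is of the form $\{\mathbf{x}\in\mathbb{R}^n : \sum_{i=1}^n x_iA_i \text{ is positive semidefinite}\}$, where $A_1,\ldots,A_n$ are real symmetric $m\times m$ matrices (for some $m$) such that $\sum_{i=1}^n y_iA_i$ is positive definite for some $(y_1,\ldots,y_n)\in\mathbb{R}^n$. *)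

theory Defs
  imports "HOL-Analysis.Analysis"
begin

definition esym :: "nat \<Rightarrow> real^'n \<Rightarrow> real" where
  "esym k x = (\<Sum>S\<in>{S. card S = k}. \<Prod>i\<in>S. x $ i)"

definition hyperbolicity_cone :: "(real^'n \<Rightarrow> real) \<Rightarrow> real^'n \<Rightarrow> (real^'n) set" where
  "hyperbolicity_cone h e = closure (connected_component_set {x. h x \<noteq> 0} e)"

definition psd_mat :: "nat \<Rightarrow> (nat \<Rightarrow> nat \<Rightarrow> real) \<Rightarrow> bool" where
  "psd_mat m M \<longleftrightarrow> (\<forall>v::nat \<Rightarrow> real. (\<Sum>a<m. \<Sum>b<m. v a * M a b * v b) \<ge> 0)"

definition pd_mat :: "nat \<Rightarrow> (nat \<Rightarrow> nat \<Rightarrow> real) \<Rightarrow> bool" where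
  "pd_mat m M \<longleftrightarrow> (\<forall>v::nat \<Rightarrow> real. (\<exists>a<m. v a \<noteq> 0) \<longrightarrow> (\<Sum>a<m. \<Sum>b<m. v a * M a b * v b) > 0)"

definition symmetric_mat :: "nat \<Rightarrow> (nat \<Rightarrow> nat \<Rightarrow> real) \<Rightarrow> bool" where
  "symmetric_mat m M \<longleftrightarrow> (\<forall>a<m. \<forall>b<m. M a b = M b a)"

definition spectrahedral :: "(real^'n) set \<Rightarrow> bool" where
  "spectrahedral C \<longleftrightarrow>
     (\<exists>(m::nat) (A :: 'n \<Rightarrow> nat \<Rightarrow> nat \<Rightarrow> real).
        (\<forall>i. symmetric_mat m (A i)) \<and>
        (\<exists>y::real^'n. pd_mat m (\<lambda>a b. \<Sum>i\<in>UNIV. y $ i * A i a b)) \<and>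
        C = {x. psd_mat m (\<lambda>a b. \<Sum>i\<in>UNIV. x $ i * A i a b)})"

end

theory Submission
  imports Defs
begin

text \<open>Write \<open>e\<^sub>k(S)\<close> for the elementary symmetric polynomial in the variables indexed by \<open>S\<close>. The ratios
  \<open>R\<^sub>k(S) = e\<^sub>k\<^sub>+\<^sub>1(S) / e\<^sub>k(S)\<close> satisfy
  \<open>(k + 1) R\<^sub>k(S) = (\<Sum>i\<in>S. x\<^sub>i R\<^sub>k\<^sub>-\<^sub>1(S - i) / (x\<^sub>i + R\<^sub>k\<^sub>-\<^sub>1(S - i)))\<close>, so \<open>R\<^sub>k(S)\<close> is the effective conductance
  of a tree-like electrical network whose edge conductances are linear in \<open>x\<close>. The energy form \<open>Q\<close> of
  this network gives the matrices. Let \<open>C\<close> be the component of \<open>e\<^sub>k\<^sub>+\<^sub>1 \<noteq> 0\<close> containing the all-ones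
  vector, \<open>P\<close> the convex set where \<open>Q\<close> is positive definite, and \<open>G\<close> the set where \<open>e\<^sub>k\<^sub>+\<^sub>1\<close> and its
  iterated derivatives along the all-ones vector and the coordinate axes are positive. The identity
  \<open>k e\<^sub>k(S) = e\<^sub>1(S) e\<^sub>k\<^sub>-\<^sub>1(S) - (\<Sum>i\<in>S. x\<^sub>i\<^sup>2 e\<^sub>k\<^sub>-\<^sub>2(S - i))\<close> shows that \<open>G\<close> is relatively closed in
  \<open>e\<^sub>k\<^sub>+\<^sub>1 \<noteq> 0\<close>, hence \<open>C \<subseteq> G\<close>. Completing squares gives \<open>G \<subseteq> P\<close>. On \<open>P\<close> the harmonic potential has
  energy \<open>R\<^sub>k > 0\<close>, hence \<open>P \<subseteq> C\<close> by convexity. So \<open>C = P\<close>, and the closure of \<open>P\<close> is the set where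
  \<open>Q\<close> is positive semidefinite.\<close>

subsection \<open>Elementary symmetric polynomials of subsets of the variables\<close>

definition esym_on :: "nat \<Rightarrow> 'i set \<Rightarrow> ('i \<Rightarrow> 'a::comm_semiring_1) \<Rightarrow> 'a" where
  "esym_on k S x = (\<Sum>T | T \<subseteq> S \<and> card T = k. \<Prod>i\<in>T. x i)"

lemma esym_eq_esym_on: "esym k x = esym_on k UNIV (($) x)"
  by (simp add: esym_def esym_on_def)

lemma esym_on_0 [simp]:
  assumes "finite S"
  shows "esym_on 0 S x = 1"
proof -
  have "{T. T \<subseteq> S \<and> card T = 0} = {{}}"
    using assms by (auto simp: card_eq_0_iff dest: finite_subset)
  then show ?thesis
    by (simp add: esym_on_def)
qed

lemma esym_on_const_1:
  assumes "finite S"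
  shows "esym_on k S (\<lambda>_. 1) = of_nat (card S choose k)"
  using assms by (simp add: esym_on_def n_subsets)

lemma mult_esym_on_remove:
  assumes "finite S" "i \<in> S"
  shows "x i * esym_on k (S - {i}) x = (\<Sum>T | T \<subseteq> S \<and> card T = Suc k \<and> i \<in> T. \<Prod>j\<in>T. x j)"
  unfolding esym_on_def sum_distrib_left
proof (rule sum.reindex_bij_witness[where i = "\<lambda>T. T - {i}" and j = "insert i"])
  fix T assume "T \<in> {T. T \<subseteq> S - {i} \<and> card T = k}"
  then have "T \<subseteq> S - {i}" "card T = k" "finite T"
    using assms(1) by (auto intro: finite_subset[of T S])
  moreover from this have "i \<notin> T"
    by blast
  ultimately show "insert i T \<in> {T. T \<subseteq> S \<and> card T = Suc k \<and> i \<in> T}"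
    and "(\<Prod>j\<in>insert i T. x j) = x i * (\<Prod>j\<in>T. x j)"
    and "insert i T - {i} = T"
    using assms(2) by auto
qed (auto simp: insert_absorb)

lemma esym_on_remove:
  assumes "finite S" "i \<in> S"
  shows "esym_on (Suc k) S x = esym_on (Suc k) (S - {i}) x + x i * esym_on k (S - {i}) x"
proof -
  let ?avoiding = "{T. T \<subseteq> S - {i} \<and> card T = Suc k}"
    and ?containing = "{T. T \<subseteq> S \<and> card T = Suc k \<and> i \<in> T}"
  have "{T. T \<subseteq> S \<and> card T = Suc k} = ?avoiding \<union> ?containing"
    by blast
  moreover have "finite ?avoiding" "finite ?containing" "?avoiding \<inter> ?containing = {}"
    using assms(1) by auto
  ultimately show ?thesis
    unfolding mult_esym_on_remove[OF assms] by (simp add: esym_on_def sum.union_disjoint)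
qed

lemma esym_on_euler:
  assumes "finite S"
  shows "(\<Sum>i\<in>S. x i * esym_on k (S - {i}) x) = of_nat (Suc k) * esym_on (Suc k) S x"
proof -
  let ?\<T> = "{T. T \<subseteq> S \<and> card T = Suc k}"
  have "(\<Sum>i\<in>S. x i * esym_on k (S - {i}) x) = (\<Sum>i\<in>S. \<Sum>T | T \<in> ?\<T> \<and> i \<in> T. \<Prod>j\<in>T. x j)"
    using assms by (simp add: mult_esym_on_remove conj_assoc)
  also have "\<dots> = (\<Sum>T\<in>?\<T>. \<Sum>i | i \<in> S \<and> i \<in> T. \<Prod>j\<in>T. x j)"
    using assms by (intro sum.swap_restrict) auto
  also have "\<dots> = (\<Sum>T\<in>?\<T>. of_nat (Suc k) * (\<Prod>j\<in>T. x j))"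
  proof (intro sum.cong refl)
    fix T assume "T \<in> ?\<T>"
    then have "{i. i \<in> S \<and> i \<in> T} = T" "card T = Suc k"
      by auto
    then show "(\<Sum>i | i \<in> S \<and> i \<in> T. \<Prod>j\<in>T. x j) = of_nat (Suc k) * (\<Prod>j\<in>T. x j)"
      by simp
  qed
  finally show ?thesis
    by (simp add: esym_on_def sum_distrib_left)
qed

lemma esym_on_1:
  assumes "finite S"
  shows "esym_on (Suc 0) S x = sum x S"
  using esym_on_euler[OF assms, of x 0] assms by simp

lemma esym_on_newton:
  fixes x :: "'i \<Rightarrow> 'a::comm_ring_1"
  assumes "finite S"
  shows "of_nat (Suc (Suc k)) * esym_on (Suc (Suc k)) S x
    = sum x S * esym_on (Suc k) S x - (\<Sum>i\<in>S. (x i)\<^sup>2 * esym_on k (S - {i}) x)"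
proof -
  have "of_nat (Suc (Suc k)) * esym_on (Suc (Suc k)) S x = (\<Sum>i\<in>S. x i * esym_on (Suc k) (S - {i}) x)"
    by (simp only: esym_on_euler[OF assms])
  also have "\<dots> = (\<Sum>i\<in>S. x i * esym_on (Suc k) S x - (x i)\<^sup>2 * esym_on k (S - {i}) x)"
    using assms by (intro sum.cong refl) (simp add: esym_on_remove algebra_simps power2_eq_square)
  finally show ?thesis
    by (simp add: sum_subtractf sum_distrib_right)
qed

lemma esym_on_Suc_nonpos:
  fixes x :: "'i \<Rightarrow> real"
  assumes "finite S" "esym_on k S x = 0" "\<And>i. i \<in> S \<Longrightarrow> 0 \<le> esym_on (k - 1) (S - {i}) x"
  shows "esym_on (Suc k) S x \<le> 0"
proof -
  obtain j where "k = Suc j"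
    using assms(1,2) by (cases k) auto
  then have "real (Suc k) * esym_on (Suc k) S x = - (\<Sum>i\<in>S. (x i)\<^sup>2 * esym_on (k - 1) (S - {i}) x)"
    using assms(2) by (simp only: esym_on_newton[OF assms(1)]) simp
  also have "\<dots> \<le> 0"
    using assms(3) by (simp add: sum_nonneg)
  finally show ?thesis
    by (simp add: mult_le_0_iff)
qed

lemma continuous_on_esym_on [continuous_intros]:
  fixes f :: "'b::topological_space \<Rightarrow> 'i \<Rightarrow> 'a::real_normed_field"
  assumes "\<And>i. i \<in> S \<Longrightarrow> continuous_on A (\<lambda>y. f y i)"
  shows "continuous_on A (\<lambda>y. esym_on k S (f y))"
  unfolding esym_on_def using assms by (intro continuous_intros) auto

subsection \<open>A description of the component by inequalities\<close>

text \<open>Up to positive factors, \<open>e\<^sub>k(S)\<close> and \<open>e\<^sub>k(S - {i})\<close> are the derivatives of \<open>e\<^sub>k\<^sub>+\<^sub>1(S)\<close> in the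
  directions of the all-ones vector and of the \<open>i\<close>-th axis, if \<open>i \<in> S\<close> and \<open>k < card S\<close>.\<close>

primrec all_esym_derivs :: "('a::comm_semiring_1 \<Rightarrow> bool) \<Rightarrow> nat \<Rightarrow> 'i set \<Rightarrow> ('i \<Rightarrow> 'a) \<Rightarrow> bool" where
  "all_esym_derivs P 0 S x \<longleftrightarrow> P (esym_on 0 S x)"
| "all_esym_derivs P (Suc k) S x \<longleftrightarrow> P (esym_on (Suc k) S x) \<and> all_esym_derivs P k S x
    \<and> (\<forall>i\<in>S. all_esym_derivs P k (S - {i}) x)"

abbreviation pos_esym_derivs :: "nat \<Rightarrow> 'i set \<Rightarrow> ('i \<Rightarrow> real) \<Rightarrow> bool" where
  "pos_esym_derivs \<equiv> all_esym_derivs (\<lambda>c. 0 < c)"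

abbreviation nonneg_esym_derivs :: "nat \<Rightarrow> 'i set \<Rightarrow> ('i \<Rightarrow> real) \<Rightarrow> bool" where
  "nonneg_esym_derivs \<equiv> all_esym_derivs (\<lambda>c. 0 \<le> c)"

lemma all_esym_derivs_imp_esym_on: "all_esym_derivs P k S x \<Longrightarrow> P (esym_on k S x)"
  by (cases k) auto

lemma all_esym_derivs_mono:
  assumes "all_esym_derivs P k S x" "\<And>c. P c \<Longrightarrow> Q c"
  shows "all_esym_derivs Q k S x"
  using assms by (induction k arbitrary: S) auto

lemma pos_esym_derivs_const_1:
  assumes "finite S" "k \<le> card S"
  shows "pos_esym_derivs k S (\<lambda>_. 1)"
  using assms by (induction k arbitrary: S) (auto simp: esym_on_const_1)

lemma open_pos_esym_derivs: "open {x::real^'n::finite. pos_esym_derivs k S (($) x)}"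
proof (induction k arbitrary: S)
  case 0
  then show ?case by simp
next
  case (Suc k)
  have "{x::real^'n. pos_esym_derivs (Suc k) S (($) x)} = {x. 0 < esym_on (Suc k) S (($) x)}
      \<inter> {x. pos_esym_derivs k S (($) x)} \<inter> (\<Inter>i\<in>S. {x. pos_esym_derivs k (S - {i}) (($) x)})"
    by auto
  then show ?case
    by (simp add: Suc.IH open_Int open_INT open_Collect_less continuous_on_esym_on
        continuous_on_component)
qed

lemma closed_nonneg_esym_derivs: "closed {x::real^'n::finite. nonneg_esym_derivs k S (($) x)}"
proof (induction k arbitrary: S)
  case 0
  then show ?case by simp
next
  case (Suc k)
  have "{x::real^'n. nonneg_esym_derivs (Suc k) S (($) x)} = {x. 0 \<le> esym_on (Suc k) S (($) x)}
      \<inter> {x. nonneg_esym_derivs k S (($) x)} \<inter> (\<Inter>i\<in>S. {x. nonneg_esym_derivs k (S - {i}) (($) x)})"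
    by auto
  then show ?case
    by (simp add: Suc.IH closed_Int closed_INT closed_Collect_le continuous_on_esym_on
        continuous_on_component)
qed

lemma nonneg_imp_pos_esym_derivs:
  assumes "finite S" "nonneg_esym_derivs k S x" "0 < esym_on k S x"
  shows "pos_esym_derivs k S x"
  using assms
proof (induction k arbitrary: S)
  case 0
  then show ?case by simp
next
  case (Suc k)
  have "0 \<le> esym_on k S x" and remove_nonneg: "\<And>i. i \<in> S \<Longrightarrow> 0 \<le> esym_on k (S - {i}) x"
    using Suc.prems(2) by (auto dest: all_esym_derivs_imp_esym_on)
  have "0 \<le> esym_on (k - 1) (T - {i}) x" if "nonneg_esym_derivs k T x" "i \<in> T" "finite T" for T i
    using that by (cases k) (auto dest: all_esym_derivs_imp_esym_on)
  then have nonpos: "esym_on (Suc k) T x \<le> 0"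
    if "nonneg_esym_derivs k T x" "esym_on k T x = 0" "finite T" for T
    using that esym_on_Suc_nonpos by blast
  have "esym_on k S x \<noteq> 0"
    using nonpos[of S] Suc.prems by auto
  moreover have "esym_on k (S - {i}) x \<noteq> 0" if "i \<in> S" for i
    using nonpos[of "S - {i}"] Suc.prems esym_on_remove[OF _ that, of k x] that by auto
  ultimately show ?case
    using Suc \<open>0 \<le> esym_on k S x\<close> remove_nonneg by (auto simp: less_le)
qed

lemma connected_component_set_subset_open:
  assumes "open G" "closure G \<inter> U \<subseteq> G" "a \<in> G"
  shows "connected_component_set U a \<subseteq> G"
proof (cases "a \<in> U")
  case True
  let ?C = "connected_component_set U a"
  have closure_eq: "?C \<inter> G = ?C \<inter> closure G"
    using assms(2) closure_subset connected_component_subset by blast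
  have "openin (top_of_set ?C) (?C \<inter> G)"
    using assms(1) by (rule openin_open_Int)
  moreover have "closedin (top_of_set ?C) (?C \<inter> G)"
    unfolding closure_eq by (intro closedin_closed_Int closed_closure)
  ultimately have "?C \<inter> G = {} \<or> ?C \<inter> G = ?C"
    using connected_connected_component connected_clopen by blast
  then show ?thesis
    using True assms(3) connected_component_refl by blast
next
  case False
  then show ?thesis
    by (simp add: connected_component_eq_empty[THEN iffD2])
qed

lemma component_subset_pos_esym_derivs:
  assumes "k \<le> CARD('n::finite)"
  shows "connected_component_set {x::real^'n. esym k x \<noteq> 0} (\<chi> i. 1) \<subseteq> {x. pos_esym_derivs k UNIV (($) x)}"
    (is "_ \<subseteq> ?G")
proof (rule connected_component_set_subset_open[OF open_pos_esym_derivs])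
  have "?G \<subseteq> {x. nonneg_esym_derivs k UNIV (($) x)}"
    by (auto elim: all_esym_derivs_mono)
  then have closure: "closure ?G \<subseteq> {x. nonneg_esym_derivs k UNIV (($) x)}"
    by (intro closure_minimal closed_nonneg_esym_derivs)
  show "closure ?G \<inter> {x. esym k x \<noteq> 0} \<subseteq> ?G"
  proof
    fix x assume "x \<in> closure ?G \<inter> {x. esym k x \<noteq> 0}"
    then have nonneg: "nonneg_esym_derivs k UNIV (($) x)" and "esym k x \<noteq> 0"
      using closure by auto
    then have "0 < esym_on k UNIV (($) x)"
      using all_esym_derivs_imp_esym_on[OF nonneg] by (simp add: esym_eq_esym_on)
    then show "x \<in> ?G"
      using nonneg by (simp add: nonneg_imp_pos_esym_derivs)
  qed
  show "(\<chi> i. 1) \<in> ?G"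
    using pos_esym_derivs_const_1[OF _ assms] by (simp add: vec_lambda_inverse)
qed

subsection \<open>Pencils of quadratic forms\<close>

lemma convex_pos_functionals:
  assumes "\<And>i. i \<in> I \<Longrightarrow> linear (f i)"
  shows "convex {x. \<forall>i\<in>I. (0::real) < f i x}"
proof -
  have "convex (f i -` {0<..})" if "i \<in> I" for i
    using that assms by (intro convex_linear_vimage) auto
  then have "convex (\<Inter>i\<in>I. f i -` {0<..})"
    by (rule convex_INT)
  then show ?thesis
    by (simp add: Collect_ball_eq vimage_def)
qed

lemma closure_pos_functionals:
  fixes f :: "'i \<Rightarrow> 'a::real_normed_vector \<Rightarrow> real"
  assumes "\<And>i. i \<in> I \<Longrightarrow> bounded_linear (f i)" and y: "\<And>i. i \<in> I \<Longrightarrow> 0 < f i y"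
  shows "closure {x. \<forall>i\<in>I. 0 < f i x} = {x. \<forall>i\<in>I. 0 \<le> f i x}"
proof
  have "closed {x. 0 \<le> f i x}" if "i \<in> I" for i
    using assms(1)[OF that] by (intro closed_Collect_le continuous_intros linear_continuous_on)
  then show "closure {x. \<forall>i\<in>I. 0 < f i x} \<subseteq> {x. \<forall>i\<in>I. 0 \<le> f i x}"
    by (intro closure_minimal) (auto simp: Collect_ball_eq less_imp_le)
  show "{x. \<forall>i\<in>I. 0 \<le> f i x} \<subseteq> closure {x. \<forall>i\<in>I. 0 < f i x}"
  proof
    fix x assume x: "x \<in> {x. \<forall>i\<in>I. 0 \<le> f i x}"
    have "0 < f i (x + inverse (real (Suc n)) *\<^sub>R y)" if "i \<in> I" for i n
    proof -
      interpret bounded_linear "f i" using assms(1)[OF that] .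
      show ?thesis
        using x y[OF that] that by (auto simp: add scaleR intro!: add_nonneg_pos)
    qed
    moreover have "(\<lambda>n. x + inverse (real (Suc n)) *\<^sub>R y) \<longlonglongrightarrow> x + 0 *\<^sub>R y"
      by (intro tendsto_intros LIMSEQ_inverse_real_of_nat)
    ultimately show "x \<in> closure {x. \<forall>i\<in>I. 0 < f i x}"
      unfolding closure_sequential by force
  qed
qed

lemma linear_axis_expansion:
  fixes f :: "real^'n::finite \<Rightarrow> 'a::real_vector"
  assumes "linear f"
  shows "f x = (\<Sum>i\<in>UNIV. x $ i *\<^sub>R f (axis i 1))"
proof -
  have "f x = f (\<Sum>i\<in>UNIV. x $ i *\<^sub>R axis i 1)"
    by (simp add: basis_expansion flip: scalar_mult_eq_scaleR)
  then show ?thesis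
    by (simp add: assms linear_sum linear_scale)
qed

definition quad_form :: "'b set \<Rightarrow> ('b \<Rightarrow> 'b \<Rightarrow> real) \<Rightarrow> ('b \<Rightarrow> real) \<Rightarrow> real" where
  "quad_form N M u = (\<Sum>p\<in>N. \<Sum>q\<in>N. u p * M p q * u q)"

definition pos_def_on :: "'b set \<Rightarrow> ('b \<Rightarrow> 'b \<Rightarrow> real) \<Rightarrow> bool" where
  "pos_def_on N M \<longleftrightarrow> (\<forall>u. (\<exists>p\<in>N. u p \<noteq> 0) \<longrightarrow> 0 < quad_form N M u)"

lemma quad_form_reindex:
  assumes "bij_betw g I N" "\<And>a. a \<in> I \<Longrightarrow> u (g a) = v a"
  shows "quad_form I (\<lambda>a b. M (g a) (g b)) v = quad_form N M u"
proof -
  have "quad_form N M u = (\<Sum>a\<in>I. \<Sum>b\<in>I. u (g a) * M (g a) (g b) * u (g b))"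
    unfolding quad_form_def by (simp only: sum.reindex_bij_betw[OF assms(1), symmetric])
  then show ?thesis
    using assms(2) by (simp add: quad_form_def)
qed

lemma bounded_linear_quad_form:
  assumes "\<And>p q. bounded_linear (\<lambda>x. M x p q)"
  shows "bounded_linear (\<lambda>x. quad_form N (M x) u)"
  unfolding quad_form_def using assms
  by (intro bounded_linear_sum bounded_linear_mult_const bounded_linear_const_mult)

lemma convex_pos_def_on:
  assumes "\<And>p q. bounded_linear (\<lambda>x. M x p q)"
  shows "convex {x. pos_def_on N (M x)}"
  using convex_pos_functionals[of "{u. \<exists>p\<in>N. u p \<noteq> 0}" "\<lambda>u x. quad_form N (M x) u"]
  by (simp add: pos_def_on_def assms bounded_linear_quad_form bounded_linear.linear)

lemma closure_pos_def_on:
  assumes "\<And>p q. bounded_linear (\<lambda>x. M x p q)" "pos_def_on N (M y)"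
  shows "closure {x. pos_def_on N (M x)} = {x. \<forall>u. 0 \<le> quad_form N (M x) u}"
proof -
  have "0 \<le> quad_form N (M x) u" if "\<forall>p\<in>N. u p = 0" for x u
    using that by (simp add: quad_form_def)
  then have "{x. \<forall>u. 0 \<le> quad_form N (M x) u} = {x. \<forall>u\<in>{u. \<exists>p\<in>N. u p \<noteq> 0}. 0 \<le> quad_form N (M x) u}"
    by blast
  also have "\<dots> = closure {x. \<forall>u\<in>{u. \<exists>p\<in>N. u p \<noteq> 0}. 0 < quad_form N (M x) u}"
    using assms by (intro closure_pos_functionals[symmetric] bounded_linear_quad_form)
      (auto simp: pos_def_on_def)
  finally show ?thesis
    by (simp add: pos_def_on_def)
qed

lemma psd_mat_iff_quad_form: "psd_mat m M \<longleftrightarrow> (\<forall>v. 0 \<le> quad_form {..<m} M v)"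
  by (simp add: psd_mat_def quad_form_def)

lemma pd_mat_iff_pos_def_on: "pd_mat m M \<longleftrightarrow> pos_def_on {..<m} M"
  by (auto simp: pd_mat_def pos_def_on_def quad_form_def)

lemma spectrahedral_closure_pos_def_on:
  fixes M :: "real^'n::finite \<Rightarrow> 'b \<Rightarrow> 'b \<Rightarrow> real"
  assumes "finite N" and linear: "\<And>p q. bounded_linear (\<lambda>x. M x p q)"
    and sym: "\<And>x p q. M x p q = M x q p" and pos_def: "pos_def_on N (M y)"
  shows "spectrahedral (closure {x. pos_def_on N (M x)})"
proof -
  obtain g where g: "bij_betw g {..<card N} N"
    using ex_bij_betw_nat_finite[OF \<open>finite N\<close>] by (auto simp: atLeast0LessThan)
  define A where "A i a b = M (axis i 1) (g a) (g b)" for i a b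
  have A: "(\<Sum>i\<in>UNIV. x $ i * A i a b) = M x (g a) (g b)" for x a b
    using linear_axis_expansion[OF bounded_linear.linear[OF linear], of x] by (simp add: A_def)
  have quad_form_pullback: "quad_form {..<card N} (\<lambda>a b. M x (g a) (g b)) (\<lambda>a. u (g a))
      = quad_form N (M x) u" for x u
    by (rule quad_form_reindex[OF g]) simp
  have quad_form_inv_into: "quad_form {..<card N} (\<lambda>a b. M x (g a) (g b)) v
      = quad_form N (M x) (v \<circ> inv_into {..<card N} g)" for x v
    using g by (intro quad_form_reindex[OF g]) (simp add: bij_betw_def)
  show ?thesis
    unfolding spectrahedral_def
  proof (intro exI conjI)
    show "\<forall>i. symmetric_mat (card N) (A i)"
      by (simp add: symmetric_mat_def A_def sym)
    have "\<exists>p\<in>N. (v \<circ> inv_into {..<card N} g) p \<noteq> 0" if "a < card N" "v a \<noteq> 0"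
      for v :: "nat \<Rightarrow> real" and a
      using that g by (intro bexI[of _ "g a"]) (auto simp: bij_betw_def)
    then show "pd_mat (card N) (\<lambda>a b. \<Sum>i\<in>UNIV. y $ i * A i a b)"
      using pos_def unfolding pd_mat_iff_pos_def_on A pos_def_on_def quad_form_inv_into by blast
    show "closure {x. pos_def_on N (M x)} = {x. psd_mat (card N) (\<lambda>a b. \<Sum>i\<in>UNIV. x $ i * A i a b)}"
      unfolding closure_pos_def_on[of M, OF linear pos_def] psd_mat_iff_quad_form A
      using quad_form_pullback quad_form_inv_into by metis
  qed
qed

subsection \<open>The energy form of the network\<close>

text \<open>Energy of a potential on the tree whose vertices are the lists of distinct elements of \<open>S\<close> of
  length at most \<open>k + 1\<close>. The edge from \<open>l\<close> to \<open>l @ [i]\<close> has conductance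
  \<open>x i / ((k + 1) k \<dots> (k + 1 - length l))\<close>, and the vertices of length \<open>k + 1\<close> are grounded.\<close>

primrec energy :: "('i \<Rightarrow> real) \<Rightarrow> nat \<Rightarrow> 'i set \<Rightarrow> ('i list \<Rightarrow> real) \<Rightarrow> ('i list \<Rightarrow> real) \<Rightarrow> real" where
  "energy x 0 S u w = sum x S * u [] * w []"
| "energy x (Suc k) S u w =
    (\<Sum>i\<in>S. x i * (u [] - u [i]) * (w [] - w [i])
      + energy x k (S - {i}) (\<lambda>l. u (i # l)) (\<lambda>l. w (i # l))) / real (k + 2)"

declare energy.simps(2) [simp del]

definition nodes :: "nat \<Rightarrow> 'i set \<Rightarrow> 'i list set" where
  "nodes k S = {l. distinct l \<and> set l \<subseteq> S \<and> length l \<le> k}"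

lemma Nil_in_nodes [simp]: "[] \<in> nodes k S"
  by (simp add: nodes_def)

lemma nodes_0: "nodes 0 S = {[]}"
  by (auto simp: nodes_def)

lemma Cons_in_nodes_Suc [simp]: "i # l \<in> nodes (Suc k) S \<longleftrightarrow> i \<in> S \<and> l \<in> nodes k (S - {i})"
  by (auto simp: nodes_def)

lemma finite_nodes:
  assumes "finite S"
  shows "finite (nodes k S)"
  by (rule finite_subset[OF _ finite_lists_length_le[OF assms, of k]]) (auto simp: nodes_def)

lemma energy_cong:
  assumes "\<And>l. l \<in> nodes k S \<Longrightarrow> u l = u' l" "\<And>l. l \<in> nodes k S \<Longrightarrow> w l = w' l"
  shows "energy x k S u w = energy x k S u' w'"
  using assms
proof (induction k arbitrary: S u u' w w')
  case 0
  then show ?case by simp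
next
  case (Suc k)
  have "energy x k (S - {i}) (\<lambda>l. u (i # l)) (\<lambda>l. w (i # l))
      = energy x k (S - {i}) (\<lambda>l. u' (i # l)) (\<lambda>l. w' (i # l))" if "i \<in> S" for i
    using that Suc.prems by (intro Suc.IH) auto
  then show ?case
    using Suc.prems by (simp add: energy.simps(2))
qed

lemma energy_commute: "energy x k S u w = energy x k S w u"
proof (induction k arbitrary: S u w)
  case 0
  then show ?case by simp
next
  case (Suc k)
  show ?case
    unfolding energy.simps by (subst Suc.IH) (simp only: mult_ac)
qed

lemma energy_scale_left: "energy x k S (\<lambda>l. c * u l) w = c * energy x k S u w"
proof (induction k arbitrary: S u w)
  case 0
  then show ?case by simp
next
  case (Suc k)
  have "x i * (c * u [] - c * u [i]) * b + c * e = c * (x i * (u [] - u [i]) * b + e)" for i b e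
    by (simp add: algebra_simps)
  then show ?case
    by (simp add: energy.simps(2) Suc.IH sum_distrib_left)
qed

lemma energy_zero_left: "energy x k S (\<lambda>l. 0) w = 0"
  using energy_scale_left[of x k S 0] by simp

lemma energy_scale: "energy x k S (\<lambda>l. c * u l) (\<lambda>l. c * u l) = c\<^sup>2 * energy x k S u u"
  by (simp add: energy_scale_left energy_commute[of x k S u "\<lambda>l. c * u l"] power2_eq_square)

lemma energy_add_left: "energy x k S (\<lambda>l. u l + v l) w = energy x k S u w + energy x k S v w"
proof (induction k arbitrary: S u v w)
  case 0
  then show ?case by (simp add: algebra_simps)
next
  case (Suc k)
  have "x i * ((u [] + v []) - (u [i] + v [i])) * b + (d + e)
      = (x i * (u [] - u [i]) * b + d) + (x i * (v [] - v [i]) * b + e)" for i b d e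
    by (simp add: algebra_simps)
  then show ?case
    by (simp add: energy.simps(2) Suc.IH sum.distrib add_divide_distrib)
qed

lemma energy_sum_left:
  "energy x k S (\<lambda>l. \<Sum>a\<in>A. v a * f a l) w = (\<Sum>a\<in>A. v a * energy x k S (f a) w)"
proof (induction A rule: infinite_finite_induct)
  case (insert a A)
  then show ?case
    by (simp only: sum.insert not_False_eq_True energy_add_left energy_scale_left)
qed (simp_all add: energy_zero_left)

lemma bounded_linear_energy: "bounded_linear (\<lambda>x::real^'n::finite. energy (($) x) k S u w)"
proof (induction k arbitrary: S u w)
  case 0
  then show ?case
    by (auto intro!: bounded_linear_mult_const bounded_linear_sum bounded_linear_vec_nth)
next
  case (Suc k)
  have "bounded_linear (\<lambda>x::real^'n. \<Sum>i\<in>S. x $ i * (u [] - u [i]) * (w [] - w [i])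
      + energy (($) x) k (S - {i}) (\<lambda>l. u (i # l)) (\<lambda>l. w (i # l)))"
    by (intro bounded_linear_sum bounded_linear_add bounded_linear_mult_const bounded_linear_vec_nth
        Suc.IH)
  then show ?case
    unfolding energy.simps by (rule bounded_linear_compose[OF bounded_linear_divide])
qed

definition branch_energy :: "('i \<Rightarrow> real) \<Rightarrow> nat \<Rightarrow> 'i set \<Rightarrow> ('i list \<Rightarrow> real) \<Rightarrow> 'i \<Rightarrow> real" where
  "branch_energy x k S u i
    = x i * (u [] - u [i])\<^sup>2 + energy x k (S - {i}) (\<lambda>l. u (i # l)) (\<lambda>l. u (i # l))"

lemma energy_Suc_eq_sum_branch_energy:
  "energy x (Suc k) S u u = (\<Sum>i\<in>S. branch_energy x k S u i) / real (k + 2)"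
  by (simp add: energy.simps(2) branch_energy_def power2_eq_square mult.assoc)

definition energy_mat :: "('i \<Rightarrow> real) \<Rightarrow> nat \<Rightarrow> 'i set \<Rightarrow> 'i list \<Rightarrow> 'i list \<Rightarrow> real" where
  "energy_mat x k S p q = energy x k S (\<lambda>l. of_bool (l = p)) (\<lambda>l. of_bool (l = q))"

lemma quad_form_energy_mat:
  assumes "finite S"
  shows "quad_form (nodes k S) (energy_mat x k S) u = energy x k S u u"
proof -
  let ?N = "nodes k S" and ?\<delta> = "\<lambda>p l. of_bool (l = p) :: real"
  have expand: "energy x k S u w = (\<Sum>p\<in>?N. u p * energy x k S (?\<delta> p) w)" for w
  proof -
    have "u l = (\<Sum>p\<in>?N. u p * ?\<delta> p l)" if "l \<in> ?N" for l
    proof -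
      have "?N \<inter> {p. l = p} = {l}"
        using that by auto
      then show ?thesis
        using assms by (simp add: finite_nodes sum_mult_of_bool_eq)
    qed
    then have "energy x k S u w = energy x k S (\<lambda>l. \<Sum>p\<in>?N. u p * ?\<delta> p l) w"
      by (rule energy_cong) simp_all
    then show ?thesis
      by (simp only: energy_sum_left)
  qed
  have "energy x k S (?\<delta> p) u = (\<Sum>q\<in>?N. energy_mat x k S p q * u q)" for p
    unfolding energy_mat_def energy_commute[of x k S "?\<delta> p"] expand[of "?\<delta> p"]
    by (simp only: mult.commute)
  then show ?thesis
    by (simp only: expand[of u] quad_form_def sum_distrib_left mult.assoc)
qed

subsection \<open>Effective conductances\<close>

definition conductance :: "nat \<Rightarrow> 'i set \<Rightarrow> ('i \<Rightarrow> real) \<Rightarrow> real" where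
  "conductance k S x = esym_on (Suc k) S x / esym_on k S x"

lemma conductance_0: "finite S \<Longrightarrow> conductance 0 S x = sum x S"
  by (simp add: conductance_def esym_on_1)

lemma add_conductance_remove:
  assumes "finite S" "i \<in> S" "esym_on k (S - {i}) x \<noteq> 0"
  shows "x i + conductance k (S - {i}) x = esym_on (Suc k) S x / esym_on k (S - {i}) x"
  using assms by (simp add: conductance_def esym_on_remove[of S i] field_simps)

lemma conductance_Suc:
  assumes "finite S" "esym_on (Suc k) S x \<noteq> 0" "\<And>i. i \<in> S \<Longrightarrow> esym_on k (S - {i}) x \<noteq> 0"
  shows "conductance (Suc k) S x
    = (\<Sum>i\<in>S. x i * conductance k (S - {i}) x / (x i + conductance k (S - {i}) x)) / real (k + 2)"
proof -
  have "(\<Sum>i\<in>S. x i * conductance k (S - {i}) x / (x i + conductance k (S - {i}) x))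
      = (\<Sum>i\<in>S. x i * esym_on (Suc k) (S - {i}) x) / esym_on (Suc k) S x"
    unfolding sum_divide_distrib using assms
    by (intro sum.cong refl) (simp add: add_conductance_remove, simp add: conductance_def)
  also have "\<dots> = real (k + 2) * conductance (Suc k) S x"
    using esym_on_euler[OF assms(1), of x "Suc k"] by (simp add: conductance_def)
  finally show ?thesis
    by simp
qed

text \<open>The left-hand side is the energy of a conductance \<open>a\<close> in series with a conductance \<open>r\<close>.\<close>

lemma series_conductance:
  fixes a r u v :: real
  assumes "a + r \<noteq> 0"
  shows "a * (u - v)\<^sup>2 + r * v\<^sup>2 = a * r / (a + r) * u\<^sup>2 + (a + r) * (v - a / (a + r) * u)\<^sup>2"
  using assms by (simp add: divide_simps) (simp add: algebra_simps power2_eq_square power3_eq_cube)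

lemma add_conductance_pos:
  assumes "finite S" "pos_esym_derivs (Suc k) S x" "i \<in> S"
  shows "0 < x i + conductance k (S - {i}) x"
proof -
  have "0 < esym_on (Suc k) S x" "0 < esym_on k (S - {i}) x"
    using assms by (auto dest: all_esym_derivs_imp_esym_on)
  then show ?thesis
    using assms by (simp add: add_conductance_remove)
qed

lemma energy_ge_conductance:
  assumes "finite S" "pos_esym_derivs (Suc k) S x"
  shows "conductance k S x * (u [])\<^sup>2 \<le> energy x k S u u"
  using assms
proof (induction k arbitrary: S u)
  case 0
  then show ?case
    by (simp add: conductance_0 power2_eq_square)
next
  case (Suc k)
  let ?r = "\<lambda>i. conductance k (S - {i}) x"
  have "x i * ?r i / (x i + ?r i) * (u [])\<^sup>2 \<le> branch_energy x k S u i" if "i \<in> S" for i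
  proof -
    have "0 < x i + ?r i"
      using Suc.prems that by (intro add_conductance_pos) auto
    then have "x i * ?r i / (x i + ?r i) * (u [])\<^sup>2 \<le> x i * (u [] - u [i])\<^sup>2 + ?r i * (u [i])\<^sup>2"
      by (simp add: series_conductance)
    also have "?r i * (u [i])\<^sup>2 \<le> energy x k (S - {i}) (\<lambda>l. u (i # l)) (\<lambda>l. u (i # l))"
      using Suc.prems that by (intro Suc.IH) auto
    finally show ?thesis
      by (simp add: branch_energy_def)
  qed
  then have "(\<Sum>i\<in>S. x i * ?r i / (x i + ?r i)) * (u [])\<^sup>2 / real (k + 2) \<le> energy x (Suc k) S u u"
    unfolding energy_Suc_eq_sum_branch_energy sum_distrib_right
    by (intro divide_right_mono sum_mono) auto
  moreover have "esym_on k (S - {i}) x \<noteq> 0" if "i \<in> S" for i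
    using all_esym_derivs_imp_esym_on[of _ k "S - {i}" x] Suc.prems(2) that by fastforce
  ultimately show ?case
    using Suc.prems by (simp add: conductance_Suc)
qed

lemma branch_energy_ge_if_root_eq_0:
  assumes "finite S" "pos_esym_derivs (Suc k) (S - {i}) x" "u [] = 0"
  shows "(x i + conductance k (S - {i}) x) * (u [i])\<^sup>2 \<le> branch_energy x k S u i"
  using energy_ge_conductance[of "S - {i}" k x "\<lambda>l. u (i # l)"] assms
  by (simp add: branch_energy_def distrib_right)

lemma energy_Suc_pos_if_root_eq_0:
  assumes "finite S" "pos_esym_derivs (Suc (Suc k)) S x" "u [] = 0" "i \<in> S"
    and "u [i] = 0 \<Longrightarrow> 0 < energy x k (S - {i}) (\<lambda>l. u (i # l)) (\<lambda>l. u (i # l))"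
  shows "0 < energy x (Suc k) S u u"
proof -
  let ?a = "\<lambda>j. x j + conductance k (S - {j}) x"
  have a_pos: "0 < ?a j" and branch_ge: "?a j * (u [j])\<^sup>2 \<le> branch_energy x k S u j" if "j \<in> S" for j
    using assms(1-3) that by (auto intro!: add_conductance_pos branch_energy_ge_if_root_eq_0)
  have "0 \<le> branch_energy x k S u j" if "j \<in> S" for j
    using a_pos[OF that] branch_ge[OF that]
    by (meson less_imp_le mult_nonneg_nonneg order_trans zero_le_power2)
  moreover have "0 < branch_energy x k S u i"
  proof (cases "u [i] = 0")
    case True
    then show ?thesis
      using assms(3,5) by (simp add: branch_energy_def)
  next
    case False
    then show ?thesis
      using a_pos branch_ge assms(4) by (meson less_le_trans mult_pos_pos zero_less_power2)
  qed
  ultimately have "0 < (\<Sum>j\<in>S. branch_energy x k S u j)"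
    using assms(1,4) by (intro sum_pos2)
  then show ?thesis
    by (simp add: energy_Suc_eq_sum_branch_energy)
qed

lemma energy_pos:
  assumes "finite S" "pos_esym_derivs (Suc k) S x" "l \<in> nodes k S" "u l \<noteq> 0"
  shows "0 < energy x k S u u"
  using assms
proof (induction k arbitrary: S u l)
  case 0
  then show ?case
    by (simp add: nodes_0 esym_on_1 mult.assoc flip: power2_eq_square)
next
  case (Suc k)
  show ?case
  proof (cases "u [] = 0")
    case False
    then have "0 < conductance (Suc k) S x * (u [])\<^sup>2"
      using Suc.prems(2) by (simp add: conductance_def)
    also have "\<dots> \<le> energy x (Suc k) S u u"
      using Suc.prems(1,2) by (rule energy_ge_conductance)
    finally show ?thesis .
  next
    case True
    then obtain i l' where l: "l = i # l'" "i \<in> S" "l' \<in> nodes k (S - {i})"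
      using Suc.prems(3,4) by (cases l) auto
    then have "0 < energy x k (S - {i}) (\<lambda>l. u (i # l)) (\<lambda>l. u (i # l))"
      using Suc.prems by (intro Suc.IH[of _ l']) auto
    then show ?thesis
      using Suc.prems(1,2) True l(2) by (intro energy_Suc_pos_if_root_eq_0)
  qed
qed

lemma pos_def_on_energy_mat:
  assumes "finite S" "pos_esym_derivs (Suc k) S x"
  shows "pos_def_on (nodes k S) (energy_mat x k S)"
  using assms by (auto simp: pos_def_on_def quad_form_energy_mat energy_pos)

subsection \<open>The harmonic potential\<close>

text \<open>The minimiser of the energy among the potentials with value \<open>1\<close> at the root. Positivity of the
  energy of potentials vanishing at the root guarantees that no denominator below vanishes.\<close>

primrec harmonic :: "('i \<Rightarrow> real) \<Rightarrow> nat \<Rightarrow> 'i set \<Rightarrow> 'i list \<Rightarrow> real" where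
  "harmonic x 0 S = (\<lambda>_. 1)"
| "harmonic x (Suc k) S =
    case_list 1 (\<lambda>i l. x i / (x i + conductance k (S - {i}) x) * harmonic x k (S - {i}) l)"

lemma harmonic_Nil [simp]: "harmonic x k S [] = 1"
  by (cases k) auto

definition energy_pos_off_root :: "('i \<Rightarrow> real) \<Rightarrow> nat \<Rightarrow> 'i set \<Rightarrow> bool" where
  "energy_pos_off_root x k S \<longleftrightarrow> (\<forall>u. u [] = 0 \<longrightarrow> (\<exists>l\<in>nodes k S. u l \<noteq> 0) \<longrightarrow> 0 < energy x k S u u)"

lemma energy_pos_off_root_branch:
  assumes "finite S" "energy_pos_off_root x (Suc k) S" "i \<in> S" "l \<in> nodes k (S - {i})" "u l \<noteq> 0"
  shows "0 < x i * (u [])\<^sup>2 + energy x k (S - {i}) u u"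
proof -
  define v where "v = case_list 0 (\<lambda>j l. of_bool (j = i) * u l)"
  have "v [] = 0" "v (i # l) \<noteq> 0" "i # l \<in> nodes (Suc k) S"
    using assms by (auto simp: v_def)
  then have "0 < energy x (Suc k) S v v"
    using assms(2) unfolding energy_pos_off_root_def by blast
  then have "0 < (\<Sum>j\<in>S. branch_energy x k S v j)"
    by (simp add: energy_Suc_eq_sum_branch_energy zero_less_divide_iff)
  also have "\<dots> = branch_energy x k S v i"
  proof -
    have "branch_energy x k S v j = 0" if "j \<noteq> i" for j
      using that by (simp add: branch_energy_def v_def energy_zero_left)
    then show ?thesis
      using assms(1,3) by (simp add: sum.remove)
  qed
  finally show ?thesis
    by (simp add: branch_energy_def v_def)
qed

lemma energy_pos_off_root_remove:
  assumes "finite S" "energy_pos_off_root x (Suc k) S" "i \<in> S"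
  shows "energy_pos_off_root x k (S - {i})"
  using energy_pos_off_root_branch[OF assms] by (fastforce simp: energy_pos_off_root_def)

lemma energy_harmonic_Suc:
  assumes "\<And>i. i \<in> S \<Longrightarrow> x i + conductance k (S - {i}) x \<noteq> 0"
    and "\<And>i. i \<in> S \<Longrightarrow>
      energy x k (S - {i}) (harmonic x k (S - {i})) (harmonic x k (S - {i})) = conductance k (S - {i}) x"
  shows "energy x (Suc k) S (harmonic x (Suc k) S) (harmonic x (Suc k) S)
    = (\<Sum>i\<in>S. x i * conductance k (S - {i}) x / (x i + conductance k (S - {i}) x)) / real (k + 2)"
proof -
  let ?r = "\<lambda>i. conductance k (S - {i}) x" and ?h = "harmonic x (Suc k) S"
  have "branch_energy x k S ?h i = x i * ?r i / (x i + ?r i)" if "i \<in> S" for i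
    unfolding branch_energy_def harmonic.simps list.case harmonic_Nil energy_scale assms(2)[OF that]
    using series_conductance[OF assms(1)[OF that], of 1 "x i / (x i + ?r i)"]
    by (simp add: mult.commute)
  then show ?thesis
    by (simp only: energy_Suc_eq_sum_branch_energy cong: sum.cong)
qed

lemma energy_harmonic:
  assumes "finite S" "k < card S" "energy_pos_off_root x k S"
  shows "esym_on k S x \<noteq> 0 \<and> energy x k S (harmonic x k S) (harmonic x k S) = conductance k S x"
  using assms
proof (induction k arbitrary: S)
  case 0
  then show ?case
    by (simp add: conductance_0)
next
  case (Suc k)
  let ?r = "\<lambda>i. conductance k (S - {i}) x"
  have nonzero_remove: "esym_on k (S - {i}) x \<noteq> 0"
    and energy_remove: "energy x k (S - {i}) (harmonic x k (S - {i})) (harmonic x k (S - {i})) = ?r i"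
    if "i \<in> S" for i
    using Suc.IH[of "S - {i}"] energy_pos_off_root_remove[OF Suc.prems(1,3) that] Suc.prems that by auto
  have denominator_pos: "0 < x i + ?r i" if "i \<in> S" for i
    using energy_pos_off_root_branch[OF Suc.prems(1,3) that, of "[]" "harmonic x k (S - {i})"]
      energy_remove[OF that] by simp
  obtain i where "i \<in> S"
    using Suc.prems(2) by fastforce
  then have nonzero: "esym_on (Suc k) S x \<noteq> 0"
    using denominator_pos[of i] nonzero_remove[of i] Suc.prems(1) by (auto simp: add_conductance_remove)
  have "energy x (Suc k) S (harmonic x (Suc k) S) (harmonic x (Suc k) S)
      = (\<Sum>i\<in>S. x i * ?r i / (x i + ?r i)) / real (k + 2)"
    using denominator_pos energy_remove by (intro energy_harmonic_Suc less_imp_neq[THEN not_sym])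
  also have "\<dots> = conductance (Suc k) S x"
    using conductance_Suc[OF Suc.prems(1) nonzero nonzero_remove] ..
  finally show ?case
    using nonzero by blast
qed

lemma esym_on_nonzero_if_pos_def_on:
  assumes "finite S" "k < card S" "pos_def_on (nodes k S) (energy_mat x k S)"
  shows "esym_on (Suc k) S x \<noteq> 0"
proof -
  have pos: "0 < energy x k S u u" if "\<exists>l\<in>nodes k S. u l \<noteq> 0" for u
    using that assms(1,3) by (auto simp: pos_def_on_def quad_form_energy_mat)
  then have "energy_pos_off_root x k S"
    by (simp add: energy_pos_off_root_def)
  moreover have "0 < energy x k S (harmonic x k S) (harmonic x k S)"
    by (intro pos bexI[of _ "[]"]) auto
  ultimately have "0 < conductance k S x"
    using energy_harmonic[OF assms(1,2)] by simp
  then show ?thesis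
    by (auto simp: conductance_def)
qed

subsection \<open>The spectrahedral representation\<close>

lemma pos_def_on_energy_mat_1:
  assumes "k < CARD('n::finite)"
  shows "pos_def_on (nodes k UNIV) (energy_mat (($) (\<chi> i::'n. 1)) k UNIV)"
proof -
  have "pos_esym_derivs (Suc k) UNIV (\<lambda>i::'n. 1)"
    using assms by (intro pos_esym_derivs_const_1) auto
  then show ?thesis
    unfolding vec_lambda_inverse[OF UNIV_I] by (intro pos_def_on_energy_mat finite)
qed

lemma component_eq_pos_def_on_energy_mat:
  assumes "k < CARD('n::finite)"
  shows "connected_component_set {x::real^'n. esym (Suc k) x \<noteq> 0} (\<chi> i. 1)
    = {x. pos_def_on (nodes k UNIV) (energy_mat (($) x) k UNIV)}" (is "?C = ?P")
proof
  have "?C \<subseteq> {x. pos_esym_derivs (Suc k) UNIV (($) x)}"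
    using assms by (intro component_subset_pos_esym_derivs) simp
  also have "\<dots> \<subseteq> ?P"
    using pos_def_on_energy_mat[OF finite] by blast
  finally show "?C \<subseteq> ?P" .
  have "connected ?P"
    by (intro convex_connected convex_pos_def_on) (simp add: energy_mat_def bounded_linear_energy)
  moreover have "?P \<subseteq> {x. esym (Suc k) x \<noteq> 0}"
    using esym_on_nonzero_if_pos_def_on[OF finite assms] by (auto simp: esym_eq_esym_on)
  ultimately show "?P \<subseteq> ?C"
    using pos_def_on_energy_mat_1[OF assms] by (intro connected_component_maximal) auto
qed

theorem theorem1:
  fixes k :: nat
  assumes "1 \<le> k" and "k \<le> CARD('n::finite)"
  shows "spectrahedral (hyperbolicity_cone (esym k :: real^'n \<Rightarrow> real) (\<chi> i. 1))"
proof -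
  obtain j where k: "k = Suc j" and j: "j < CARD('n)"
    using assms by (cases k) auto
  have "hyperbolicity_cone (esym k) (\<chi> i. 1)
      = closure {x::real^'n. pos_def_on (nodes j UNIV) (energy_mat (($) x) j UNIV)}"
    unfolding hyperbolicity_cone_def k component_eq_pos_def_on_energy_mat[OF j] ..
  moreover have "spectrahedral \<dots>"
  proof (rule spectrahedral_closure_pos_def_on)
    show "finite (nodes j (UNIV :: 'n set))"
      by (simp add: finite_nodes)
    show "bounded_linear (\<lambda>x::real^'n. energy_mat (($) x) j UNIV p q)" for p q
      unfolding energy_mat_def by (rule bounded_linear_energy)
    show "energy_mat (($) x) j UNIV p q = energy_mat (($) x) j UNIV q p" for x :: "real^'n" and p q
      unfolding energy_mat_def by (rule energy_commute)
  qed (rule pos_def_on_energy_mat_1[OF j])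
  ultimately show ?thesis
    by simp
qed

end
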